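(* Let $\lambda>0$, $\psi,\phi\in(0,\pi)$, $x\in\mathbb{R}$, and let $\rho\in\mathbb{C}$ be such that $$|\rho|\,\bigl(\sin\phi+|\sin(\psi-\phi)|\bigr)<\sin\psi.$$ Then $$ (1-e^{i\phi}\rho)^{-\lambda+ix}(1-e^{-i\phi}\rho)^{-\lambda-ix}=\left(1-\rho\,\frac{\sin(\psi-\phi)}{\sin\psi}\right)^{-2\lambda}\sum_{k=0}^\infty P_k^{(\lambda)}(x;\psi)\,\tilde\rho^{\,k}, $$ where $$\tilde\rho=\frac{\rho\sin\phi}{\sin\psi-\rho\sin(\psi-\phi)}.$$
   Context: The Pochhammer symbol is $(z)_n=\prod_{i=1}^n(z+i-1)$, and ${}_2F_1(a_1,a_2;b_1;z)=\sum_{n\ge0}\frac{(a_1)_n(a_2)_n}{(b_1)_n}\frac{z^n}{n!}$. The Meixner-Pollaczek polynomials are $$P_n^{(\lambda)}(x;\phi)=\frac{(2\lambda)_n}{n!}e^{in\phi}\ {}_2F_1\!\left(\begin{matrix}-n,\ \lambda+ix\\ 2\lambda\end{matrix};1-e^{-2i\phi}\right).$$ The assumption on $\rho$ implies $|\rho|<1$; all complex powers are taken with the principal branch. *)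

theory Defs
  imports "HOL-Analysis.Analysis"
begin

definition hyp2F1 :: "complex \<Rightarrow> complex \<Rightarrow> complex \<Rightarrow> complex \<Rightarrow> complex" where
  "hyp2F1 a1 a2 b1 z =
     (\<Sum>n. pochhammer a1 n * pochhammer a2 n / pochhammer b1 n * (z ^ n / fact n))"

text \<open>The series below terminates, because \<open>pochhammer (- of_nat n) k = 0\<close> for \<open>k > n\<close>;
  so there is no issue of convergence although its argument may have modulus up to 2.\<close>

definition meixner_pollaczek :: "nat \<Rightarrow> real \<Rightarrow> real \<Rightarrow> real \<Rightarrow> complex" where
  "meixner_pollaczek n l x \<phi> =
     complex_of_real (pochhammer (2 * l) n / fact n) * exp (\<i> * of_nat n * of_real \<phi>) *
     hyp2F1 (- of_nat n) (of_real l + \<i> * of_real x) (2 * of_real l)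
       (1 - exp (- 2 * \<i> * of_real \<phi>))"

end

theory Submission imports Defs begin

text \<open>Write \<open>a = \<lambda> + ix\<close>, \<open>b = \<lambda> - ix\<close>. Multiplying two binomial series, expanding powers of \<open>w\<close>
  around \<open>1\<close> and summing by Vandermonde's convolution shows that the Meixner-Pollaczek polynomials
  have generating function \<open>(1 - e\<^sup>i\<^sup>\<psi> t)\<^sup>-\<^sup>b (1 - e\<^sup>-\<^sup>i\<^sup>\<psi> t)\<^sup>-\<^sup>a\<close> in the unit disc. For \<open>t = \<rho>t\<close> one has
  \<open>1 - e\<^sup>\<plusminus>\<^sup>i\<^sup>\<phi> \<rho> = (1 - e\<^sup>\<plusminus>\<^sup>i\<^sup>\<psi> t) (1 - \<rho> sin (\<psi> - \<phi>) / sin \<psi>)\<close>, where both factors lie in the right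
  half-plane, so that principal powers are multiplicative.\<close>

text \<open>After the shift \<open>k = m + j\<close>, the symbol \<open>pochhammer a (m + j)\<close>
  splits off \<open>pochhammer a j\<close>, and the factorials regroup into
  \<open>(n - j) choose m\<close>. What remains is Vandermonde's convolution for the parameters
  \<open>a + j\<close> and \<open>b\<close>.\<close>

lemma pochhammer_convolution_shift:
  fixes a b :: complex
  assumes "j \<le> n"
  shows "(\<Sum>k=j..n. pochhammer b (n - k) / fact (n - k) * (pochhammer a k / fact k) * of_nat (k choose j)) =
    pochhammer a j / fact j * (pochhammer (a + b + of_nat j) (n - j) / fact (n - j))"
proof -
  have "(\<Sum>k=j..n. pochhammer b (n - k) / fact (n - k) * (pochhammer a k / fact k) * of_nat (k choose j)) =
     (\<Sum>m\<le>n-j. pochhammer b (n - (m + j)) / fact (n - (m + j)) * (pochhammer a (m + j) / fact (m + j)) * of_nat ((m + j) choose j))"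
    by (rule sum.reindex_bij_witness[of _ "\<lambda>m. m + j" "\<lambda>k. k - j"]) (use assms in auto)
  also have "\<dots> = (\<Sum>m\<le>n-j. pochhammer a j / fact j / fact (n - j) *
     (of_nat ((n - j) choose m) * pochhammer (a + of_nat j) m * pochhammer b (n - j - m)))"
  proof (rule sum.cong)
    fix m assume "m \<in> {..n - j}"
    hence m: "m \<le> n - j" by simp
    have 1: "of_nat ((m + j) choose j) = (fact (m + j) / (fact j * fact m) :: complex)"
      by (subst binomial_fact) auto
    have 2: "of_nat ((n - j) choose m) = (fact (n - j) / (fact m * fact (n - j - m)) :: complex)"
      using m by (subst binomial_fact) auto
    have 3: "pochhammer a (m + j) = pochhammer a j * pochhammer (a + of_nat j) m"
      using pochhammer_product'[of a j m] by (simp add: add.commute)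
    have 4: "n - (m + j) = n - j - m" by simp
    show "pochhammer b (n - (m + j)) / fact (n - (m + j)) * (pochhammer a (m + j) / fact (m + j)) * of_nat ((m + j) choose j)
      = pochhammer a j / fact j / fact (n - j) *
     (of_nat ((n - j) choose m) * pochhammer (a + of_nat j) m * pochhammer b (n - j - m))"
      unfolding 1 2 3 4 by (simp add: field_simps)
  qed auto
  also have "\<dots> = pochhammer a j / fact j / fact (n - j) * pochhammer (a + of_nat j + b) (n - j)"
    by (simp add: pochhammer_binomial_sum sum_distrib_left)
  finally show ?thesis by (simp add: algebra_simps)
qed

text \<open>Both sides are the coefficient of t^n in (1 - t)^(-b) (1 - w t)^(-a), the right one
  re-expanded around w = 1. Expanding each \<open>w ^ k\<close> in powers of \<open>w - 1\<close>
  and exchanging the sums leaves the preceding lemma as inner sum.\<close>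

lemma pochhammer_convolution:
  fixes a b w :: complex
  shows "(\<Sum>k\<le>n. pochhammer b (n - k) / fact (n - k) * (pochhammer a k / fact k) * w ^ k) =
    (\<Sum>j\<le>n. pochhammer a j / fact j * (pochhammer (a + b + of_nat j) (n - j) / fact (n - j)) * (w - 1) ^ j)"
proof -
  have "(\<Sum>k\<le>n. pochhammer b (n - k) / fact (n - k) * (pochhammer a k / fact k) * w ^ k) =
    (\<Sum>k\<le>n. \<Sum>j\<le>n. if j \<le> k then pochhammer b (n - k) / fact (n - k) * (pochhammer a k / fact k) * of_nat (k choose j) * (w - 1) ^ j else 0)"
  proof (rule sum.cong)
    fix k assume "k \<in> {..n}"
    hence k: "{..n} \<inter> {j. j \<le> k} = {..k}" by auto
    have "w ^ k = (\<Sum>j\<le>k. of_nat (k choose j) * (w - 1) ^ j)"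
      using binomial_ring[of "w - 1" 1 k] by simp
    thus "pochhammer b (n - k) / fact (n - k) * (pochhammer a k / fact k) * w ^ k =
      (\<Sum>j\<le>n. if j \<le> k then pochhammer b (n - k) / fact (n - k) * (pochhammer a k / fact k) * of_nat (k choose j) * (w - 1) ^ j else 0)"
      by (simp add: sum.If_cases k sum_distrib_left mult.assoc)
  qed auto
  also have "\<dots> = (\<Sum>j\<le>n. \<Sum>k\<le>n. if j \<le> k then pochhammer b (n - k) / fact (n - k) * (pochhammer a k / fact k) * of_nat (k choose j) * (w - 1) ^ j else 0)"
    by (rule sum.swap)
  also have "\<dots> = (\<Sum>j\<le>n. (\<Sum>k=j..n. pochhammer b (n - k) / fact (n - k) * (pochhammer a k / fact k) * of_nat (k choose j)) * (w - 1) ^ j)"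
  proof (rule sum.cong)
    fix j assume "j \<in> {..n}"
    have "{..n} \<inter> {k. j \<le> k} = {j..n}" by auto
    thus "(\<Sum>k\<le>n. if j \<le> k then pochhammer b (n - k) / fact (n - k) * (pochhammer a k / fact k) * of_nat (k choose j) * (w - 1) ^ j else 0)
      = (\<Sum>k=j..n. pochhammer b (n - k) / fact (n - k) * (pochhammer a k / fact k) * of_nat (k choose j)) * (w - 1) ^ j"
      by (simp add: sum.If_cases sum_distrib_right)
  qed auto
  also have "\<dots> = (\<Sum>j\<le>n. pochhammer a j / fact j * (pochhammer (a + b + of_nat j) (n - j) / fact (n - j)) * (w - 1) ^ j)"
    by (intro sum.cong refl) (simp only: atMost_iff pochhammer_convolution_shift)
  finally show ?thesis .
qed

lemma hyp2F1_terminating: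
  "hyp2F1 (- of_nat n) a c z =
    (\<Sum>k\<le>n. pochhammer (- of_nat n) k * pochhammer a k / pochhammer c k * (z ^ k / fact k))"
  unfolding hyp2F1_def by (rule suminf_finite) (auto simp: pochhammer_of_nat_eq_0_lemma)

lemma pochhammer_minus_of_nat:
  assumes "k \<le> n"
  shows "pochhammer (- of_nat n :: complex) k = (- 1) ^ k * fact n / fact (n - k)"
proof -
  have "fact n = fact (n - k) * pochhammer (of_nat (n - k) + 1 :: complex) k"
    using assms pochhammer_product'[of 1 "n - k" k]
    by (simp add: pochhammer_fact add.commute del: of_nat_diff)
  moreover have "of_nat n - of_nat k + 1 = (of_nat (n - k) + 1 :: complex)"
    using assms by (simp add: of_nat_diff)
  ultimately show ?thesis by (simp add: pochhammer_minus)
qed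

text \<open>This exhibits the polynomial as a coefficient of a Cauchy product of two binomial
  series. Since (2 l)_n / (2 l)_k = (2 l + k)_(n-k), the terminating series is the right-hand side
  of \<open>pochhammer_convolution\<close> with w = exp(-2 i \<psi>) and a + b = 2 l.\<close>

lemma meixner_pollaczek_convolution:
  assumes "l > 0"
  shows "meixner_pollaczek n l x \<psi> =
    (\<Sum>k\<le>n. pochhammer (of_real l + \<i> * of_real x) k / fact k * exp (- \<i> * of_real \<psi>) ^ k *
      (pochhammer (of_real l - \<i> * of_real x) (n - k) / fact (n - k) * exp (\<i> * of_real \<psi>) ^ (n - k)))"
proof -
  define a b where "a = of_real l + \<i> * of_real x" and "b = of_real l - \<i> * of_real x"
  define e where "e = exp (\<i> * of_real \<psi>)"
  define w where "w = exp (- 2 * \<i> * of_real \<psi>)"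
  have ab: "a + b = 2 * of_real l" by (simp add: a_def b_def)
  have e0: "e \<noteq> 0" by (simp add: e_def)
  have e': "exp (- \<i> * of_real \<psi>) = inverse e"
    by (simp add: e_def exp_minus)
  have "w = exp (- (\<i> * of_real \<psi>)) * exp (- (\<i> * of_real \<psi>))"
    unfolding w_def by (subst exp_add[symmetric]) (simp add: algebra_simps)
  hence w: "w = inverse e * inverse e"
    by (simp add: e_def exp_minus)
  have en: "exp (\<i> * of_nat n * of_real \<psi>) = e ^ n"
    unfolding e_def by (subst exp_of_nat_mult[symmetric]) (simp add: algebra_simps)
  \<comment> \<open>Positivity of \<open>l\<close> keeps the denominators of the hypergeometric
    terms away from zero, which permits cancelling them below.\<close>
  have poch0: "pochhammer (a + b) k \<noteq> 0" for k
  proof -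
    have "pochhammer (2 * l) k > 0" using assms by (intro pochhammer_pos) simp
    moreover have "pochhammer (a + b) k = complex_of_real (pochhammer (2 * l) k)"
      unfolding ab by (simp flip: pochhammer_of_real)
    ultimately show ?thesis by simp
  qed
  have "meixner_pollaczek n l x \<psi> = pochhammer (a + b) n / fact n * e ^ n *
     (\<Sum>k\<le>n. pochhammer (- of_nat n) k * pochhammer a k / pochhammer (a + b) k * ((1 - w) ^ k / fact k))"
    unfolding meixner_pollaczek_def hyp2F1_terminating en ab
    by (simp add: a_def w_def flip: pochhammer_of_real)
  also have "\<dots> = e ^ n * (\<Sum>k\<le>n. pochhammer a k / fact k * (pochhammer (a + b + of_nat k) (n - k) / fact (n - k)) * (w - 1) ^ k)"
    unfolding sum_distrib_left
  proof (rule sum.cong)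
    fix k assume "k \<in> {..n}"
    hence k: "k \<le> n" by simp
    \<comment> \<open>The sign of \<open>pochhammer (- of_nat n) k\<close> is absorbed by passing
      from \<open>1 - w\<close> to \<open>w - 1\<close>.\<close>
    have 1: "(w - 1) ^ k = (-1) ^ k * (1 - w) ^ k"
      by (simp flip: power_mult_distrib)
    have 2: "pochhammer (a + b) n = pochhammer (a + b) k * pochhammer (a + b + of_nat k) (n - k)"
      using k by (rule pochhammer_product)
    show "pochhammer (a + b) n / fact n * e ^ n * (pochhammer (- of_nat n) k * pochhammer a k / pochhammer (a + b) k * ((1 - w) ^ k / fact k))
      = e ^ n * (pochhammer a k / fact k * (pochhammer (a + b + of_nat k) (n - k) / fact (n - k)) * (w - 1) ^ k)"
      unfolding 1 2 pochhammer_minus_of_nat[OF k] using poch0[of k] by (simp add: field_simps)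
  qed auto
  also have "\<dots> = e ^ n * (\<Sum>k\<le>n. pochhammer b (n - k) / fact (n - k) * (pochhammer a k / fact k) * w ^ k)"
    by (simp only: pochhammer_convolution)
  also have "\<dots> = (\<Sum>k\<le>n. pochhammer a k / fact k * inverse e ^ k * (pochhammer b (n - k) / fact (n - k) * e ^ (n - k)))"
    unfolding sum_distrib_left
  proof (rule sum.cong)
    fix k assume "k \<in> {..n}"
    \<comment> \<open>As w = e^(-2), the phase e^n w^k equals e^(-k) e^(n-k), one power for each
      binomial series.\<close>
    hence "e ^ n = e ^ k * e ^ (n - k)" by (simp flip: power_add)
    thus "e ^ n * (pochhammer b (n - k) / fact (n - k) * (pochhammer a k / fact k) * w ^ k) =
       pochhammer a k / fact k * inverse e ^ k * (pochhammer b (n - k) / fact (n - k) * e ^ (n - k))"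
      using e0 by (simp add: w power_mult_distrib field_simps)
  qed auto
  finally show ?thesis unfolding e' by (simp only: a_def b_def e_def)
qed

text \<open>This is the generalized binomial theorem at \<open>- z\<close> with exponent
  \<open>- a\<close>, where the signs cancel. The absolute convergence is what the Cauchy product
  requires.\<close>

lemma binomial_series_pochhammer:
  fixes a z :: complex
  assumes "cmod z < 1"
  shows "(\<lambda>n. pochhammer a n / fact n * z ^ n) sums (1 - z) powr (- a)"
    and "summable (\<lambda>n. norm (pochhammer a n / fact n * z ^ n))"
proof -
  have eq: "((- a) gchoose n) * (- z) ^ n = pochhammer a n / fact n * z ^ n" for n
    by (simp add: gbinomial_pochhammer power_mult_distrib[symmetric] flip: mult.assoc)
  show "(\<lambda>n. pochhammer a n / fact n * z ^ n) sums (1 - z) powr (- a)"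
    using gen_binomial_complex[of "- z" "- a"] assms by (simp add: eq)
  \<comment> \<open>The radius is infinite when \<open>- a\<close> is a natural number and 1
    otherwise; the lower bound covers both cases.\<close>
  have "1 \<le> conv_radius (\<lambda>n. (- a) gchoose n)"
    by (simp add: conv_radius_gchoose)
  hence "ereal (norm (- z)) < conv_radius (\<lambda>n. (- a) gchoose n)"
    using assms by (metis ereal_less(3) less_le_trans norm_minus_cancel)
  from abs_summable_in_conv_radius[OF this]
  show "summable (\<lambda>n. norm (pochhammer a n / fact n * z ^ n))"
    by (simp only: eq)
qed

text \<open>The two binomial series are taken at \<open>f * t\<close> and \<open>e * t\<close>. Both
  arguments have the modulus of \<open>t\<close>, as the phases are unimodular, so the product
  series converges in the whole unit disc.\<close>

lemma meixner_pollaczek_generating_function: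
  assumes "l > 0" and t: "cmod t < 1"
  shows "(\<lambda>k. meixner_pollaczek k l x \<psi> * t ^ k) sums
    ((1 - exp (\<i> * of_real \<psi>) * t) powr (- of_real l + \<i> * of_real x) *
     (1 - exp (- \<i> * of_real \<psi>) * t) powr (- of_real l - \<i> * of_real x))"
proof -
  define a b where "a = of_real l + \<i> * of_real x" and "b = of_real l - \<i> * of_real x"
  define e f where "e = exp (\<i> * of_real \<psi>)" and "f = exp (- \<i> * of_real \<psi>)"
  have "cmod e = 1" "cmod f = 1" by (simp_all add: e_def f_def norm_exp_eq_Re)
  hence et: "cmod (e * t) < 1" and ft: "cmod (f * t) < 1"
    using t by (simp_all add: norm_mult)
  have coeff: "(\<Sum>k\<le>n. pochhammer a k / fact k * (f * t) ^ k * (pochhammer b (n - k) / fact (n - k) * (e * t) ^ (n - k)))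
    = meixner_pollaczek n l x \<psi> * t ^ n" for n
    unfolding meixner_pollaczek_convolution[OF assms(1)] sum_distrib_right
    unfolding a_def[symmetric] b_def[symmetric] e_def[symmetric] f_def[symmetric]
  proof (rule sum.cong)
    fix k assume "k \<in> {..n}"
    hence "t ^ n = t ^ k * t ^ (n - k)" by (simp flip: power_add)
    thus "pochhammer a k / fact k * (f * t) ^ k * (pochhammer b (n - k) / fact (n - k) * (e * t) ^ (n - k)) =
      pochhammer a k / fact k * f ^ k * (pochhammer b (n - k) / fact (n - k) * e ^ (n - k)) * t ^ n"
      by (simp add: power_mult_distrib)
  qed auto
  have "(\<lambda>n. \<Sum>k\<le>n. pochhammer a k / fact k * (f * t) ^ k * (pochhammer b (n - k) / fact (n - k) * (e * t) ^ (n - k)))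
    sums ((\<Sum>k. pochhammer a k / fact k * (f * t) ^ k) * (\<Sum>k. pochhammer b k / fact k * (e * t) ^ k))"
    by (intro Cauchy_product_sums binomial_series_pochhammer(2) et ft)
  also have "(\<Sum>k. pochhammer a k / fact k * (f * t) ^ k) = (1 - f * t) powr (- a)"
    using binomial_series_pochhammer(1)[OF ft] by (simp add: sums_iff)
  also have "(\<Sum>k. pochhammer b k / fact k * (e * t) ^ k) = (1 - e * t) powr (- b)"
    using binomial_series_pochhammer(1)[OF et] by (simp add: sums_iff)
  finally show ?thesis
    unfolding coeff by (simp add: a_def b_def e_def f_def mult.commute)
qed

text \<open>Both principal arguments lie strictly between -pi/2 and pi/2, so their sum stays within
  the principal range and \<open>Ln\<close> is additive without a multiple of 2 pi i.\<close>

lemma powr_mult_Re_pos: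
  fixes u v c :: complex
  assumes "Re u > 0" "Re v > 0"
  shows "(u * v) powr c = u powr c * v powr c"
proof -
  have "\<bar>Im (Ln u)\<bar> < pi / 2" "\<bar>Im (Ln v)\<bar> < pi / 2"
    using assms using Re_Ln_pos_lt_imp by blast+
  moreover have "u \<noteq> 0" "v \<noteq> 0" using assms by auto
  ultimately have "Ln (u * v) = Ln u + Ln v"
    by (intro Ln_times_simple) auto
  thus ?thesis using \<open>u \<noteq> 0\<close> \<open>v \<noteq> 0\<close> by (simp add: powr_def exp_add algebra_simps)
qed

lemma Re_one_minus_pos: "cmod z < 1 \<Longrightarrow> Re (1 - z) > 0"
  using complex_Re_le_cmod[of z] by simp

text \<open>In the real part, the term cos \<psi> sin \<phi> of the addition formula cancels. The
  identity is what makes \<open>1 - exp (\<i> * of_real \<phi>) * \<rho>\<close> factor under the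
  substitution by \<open>\<rho>t\<close>.\<close>

lemma sin_diff_add_exp:
  "of_real (sin (\<psi> - \<phi>)) + exp (\<i> * of_real \<psi>) * of_real (sin \<phi>) = of_real (sin \<psi>) * exp (\<i> * of_real \<phi>)"
  by (simp add: complex_eq_iff sin_diff Re_exp Im_exp algebra_simps)

theorem theorem5p3:
  fixes l \<psi> \<phi> x :: real and \<rho> :: complex
  assumes "l > 0"
    and "\<psi> \<in> {0<..<pi}" and "\<phi> \<in> {0<..<pi}"
    and "cmod \<rho> * (sin \<phi> + \<bar>sin (\<psi> - \<phi>)\<bar>) < sin \<psi>"
  defines "\<rho>t \<equiv> \<rho> * of_real (sin \<phi>) / (of_real (sin \<psi>) - \<rho> * of_real (sin (\<psi> - \<phi>)))"
  shows "summable (\<lambda>k. meixner_pollaczek k l x \<psi> * \<rho>t ^ k) \<and>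
    (1 - exp (\<i> * of_real \<phi>) * \<rho>) powr (- of_real l + \<i> * of_real x) *
    (1 - exp (- \<i> * of_real \<phi>) * \<rho>) powr (- of_real l - \<i> * of_real x) =
    (1 - \<rho> * of_real (sin (\<psi> - \<phi>) / sin \<psi>)) powr (- 2 * of_real l) *
    (\<Sum>k. meixner_pollaczek k l x \<psi> * \<rho>t ^ k)"
proof -
  have s\<psi>: "sin \<psi> > 0" and s\<phi>: "sin \<phi> > 0"
    using assms(2,3) by (auto intro: sin_gt_zero)
  \<comment> \<open>\<open>d\<close> is the denominator of \<open>\<rho>t\<close>, and
    \<open>v\<close> is \<open>d\<close> divided by \<open>sin \<psi>\<close>, the base of the
    prefactor.\<close>
  define d where "d = complex_of_real (sin \<psi>) - \<rho> * of_real (sin (\<psi> - \<phi>))"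
  define v where "v = 1 - \<rho> * of_real (sin (\<psi> - \<phi>) / sin \<psi>)"
  have bound: "cmod \<rho> * sin \<phi> + cmod \<rho> * \<bar>sin (\<psi> - \<phi>)\<bar> < sin \<psi>"
    using assms(4) by (simp add: distrib_left)
  \<comment> \<open>The reverse triangle inequality turns the hypothesis into
    \<open>cmod \<rho> * sin \<phi> < cmod d\<close>, which yields both \<open>d \<noteq> 0\<close>
    and \<open>cmod \<rho>t < 1\<close>.\<close>
  have "cmod (complex_of_real (sin \<psi>)) - cmod (\<rho> * of_real (sin (\<psi> - \<phi>))) \<le> cmod d"
    unfolding d_def by (rule norm_triangle_ineq2)
  hence "sin \<psi> - cmod \<rho> * \<bar>sin (\<psi> - \<phi>)\<bar> \<le> cmod d"
    using s\<psi> by (simp add: norm_mult)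
  hence dgt: "cmod \<rho> * sin \<phi> < cmod d" using bound by linarith
  moreover have "0 \<le> cmod \<rho> * sin \<phi>" using s\<phi> by simp
  ultimately have "cmod d > 0" by linarith
  hence d0: "d \<noteq> 0" by auto
  have t: "cmod \<rho>t < 1"
    using dgt \<open>cmod d > 0\<close> s\<phi> unfolding \<rho>t_def d_def[symmetric]
    by (simp add: norm_mult norm_divide)
  have dv: "d = of_real (sin \<psi>) * v"
    using s\<psi> by (simp add: d_def v_def field_simps)
  \<comment> \<open>Dropping the nonnegative term \<open>cmod \<rho> * sin \<phi>\<close> from the
    bound suffices to place \<open>v\<close> in the right half-plane.\<close>
  have "cmod (\<rho> * of_real (sin (\<psi> - \<phi>) / sin \<psi>)) < 1"
    using bound s\<psi> \<open>0 \<le> cmod \<rho> * sin \<phi>\<close> by (simp add: norm_mult norm_divide)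
  hence v: "Re v > 0" unfolding v_def by (rule Re_one_minus_pos)
  \<comment> \<open>The phases are kept abstract, tied only by the sine identity, so that one
    computation serves both signs of the exponent. Multiplying by \<open>sin \<psi>\<close> replaces
    \<open>v\<close> by \<open>d\<close>, which clears the denominator of
    \<open>\<rho>t\<close>.\<close>
  have cis_factor: "1 - E\<phi> * \<rho> = (1 - E\<psi> * \<rho>t) * v"
    if "of_real (sin (\<psi> - \<phi>)) + E\<psi> * of_real (sin \<phi>) = of_real (sin \<psi>) * E\<phi>" for E\<phi> E\<psi> :: complex
  proof -
    have "of_real (sin \<psi>) * ((1 - E\<psi> * \<rho>t) * v) = (1 - E\<psi> * \<rho>t) * d"
      by (simp add: dv)
    also have "\<dots> = d - E\<psi> * (\<rho> * of_real (sin \<phi>))"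
      using d0 unfolding \<rho>t_def d_def[symmetric] by (simp add: field_simps)
    also have "\<dots> = of_real (sin \<psi>) - \<rho> * (of_real (sin (\<psi> - \<phi>)) + E\<psi> * of_real (sin \<phi>))"
      by (simp add: d_def algebra_simps)
    also have "\<dots> = of_real (sin \<psi>) * (1 - E\<phi> * \<rho>)"
      unfolding that by (simp add: algebra_simps)
    finally show ?thesis using s\<psi> by simp
  qed
  have f1: "1 - exp (\<i> * of_real \<phi>) * \<rho> = (1 - exp (\<i> * of_real \<psi>) * \<rho>t) * v"
    by (intro cis_factor sin_diff_add_exp)
  \<comment> \<open>The required identity is the complex conjugate of
    \<open>sin_diff_add_exp\<close>, whose sine coefficients are real.\<close>
  have f2: "1 - exp (- \<i> * of_real \<phi>) * \<rho> = (1 - exp (- \<i> * of_real \<psi>) * \<rho>t) * v"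
    by (intro cis_factor) (simp add: complex_eq_iff sin_diff Re_exp Im_exp algebra_simps)
  have p1: "Re (1 - exp (\<i> * of_real \<psi>) * \<rho>t) > 0"
    by (rule Re_one_minus_pos) (use t in \<open>simp add: norm_mult norm_exp_eq_Re\<close>)
  have p2: "Re (1 - exp (- \<i> * of_real \<psi>) * \<rho>t) > 0"
    by (rule Re_one_minus_pos) (use t in \<open>simp add: norm_mult norm_exp_eq_Re\<close>)
  \<comment> \<open>The two exponents add up to -2 l, so the powers of \<open>v\<close> split off
    from both factors merge into the prefactor.\<close>
  have vv: "v powr (- 2 * of_real l) = v powr (- of_real l + \<i> * of_real x) * v powr (- of_real l - \<i> * of_real x)"
    by (subst powr_add[symmetric]) simp
  note gf = meixner_pollaczek_generating_function[OF assms(1) t, of x \<psi>]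
  show ?thesis
    unfolding f1 f2 powr_mult_Re_pos[OF p1 v] powr_mult_Re_pos[OF p2 v] sums_unique[OF gf, symmetric]
      v_def[symmetric] vv
    using sums_summable[OF gf] by (simp only: mult_ac)
qed

end
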